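(* Let $\lambda$ be a fixed nonzero real number, and let $S_{f,\lambda}(n,k,H)$ and ${n \brace k}_{f,\lambda}(H)$ be the degenerate generalized Stirling operators of the first and second kind associated with the generalized Heisenberg algebra $\mathrm{GHA}_f$. For all integers $n,j\ge 0$, $$\sum_{k=j}^{n}S_{f,\lambda}(n,k,H){k \brace j}_{f,\lambda}(H)=\delta_{n,j}\qquad\text{and}\qquad \sum_{k=j}^{n}{n \brace k}_{f,\lambda}(H)\,S_{f,\lambda}(k,j,H)=\delta_{n,j},$$ where $\delta_{n,j}$ is the Kronecker delta.
   Context: The generalized Heisenberg algebra $\mathrm{GHA}_f$ is the algebra generated by $\{a,a^{\dagger},H\}$ (together with functions of $H$) subject to the relations $$aH=f(H)a,\qquad Ha^{\dagger}=a^{\dagger}f(H),\qquad [a,a^{\dagger}]=aa^{\dagger}-a^{\dagger}a=f(H)-H,$$ where $H$ is the self-conjugate Hamiltonian and $f(H)$ is an analytic function of $H$; $f$ is assumed to have a compositional inverse $f^{-1}$. Functions of $H$ commute with each other, and the first two relations extend to functions $g$ of $H$: $a\,g(H)=g(f(H))\,a$ and $g(H)\,a^{\dagger}=a^{\dagger}g(f(H))$. Degenerate falling factorials: $(x)_{0,\lambda}=1$ and $(x)_{n,\lambda}=x(x-\lambda)(x-2\lambda)\cdots(x-(n-1)\lambda)$ for $n\ge 1$. The degenerate generalized Stirling operators of the second kind ${n \brace k}_{f,\lambda}(H)$ are the functions of $H$ defined by $$(a^{\dagger}a)_{n,\lambda}=\sum_{k=0}^{n}{n \brace k}_{f,\lambda}(H)\,(a^{\dagger})^{k}a^{k}\qquad(n\ge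 0),$$ and the degenerate generalized Stirling operators of the first kind $S_{f,\lambda}(n,k,H)$ are the functions of $H$ defined by the inverse relation $$(a^{\dagger})^{n}a^{n}=\sum_{k=0}^{n}S_{f,\lambda}(n,k,H)\,(a^{\dagger}a)_{k,\lambda}\qquad(n\ge 0).$$ The coefficients (functions of $H$, written on the left) in both kinds of expansion are understood to be uniquely determined, i.e. the elements $(a^{\dagger}a)_{k,\lambda}$, $k\ge 0$, are linearly independent over the functions of $H$, and likewise the elements $(a^{\dagger})^{k}a^{k}$. Empty sums (when $j>n$) are $0$. *)

theory Defs
  imports Complex_Main
begin

definition real_analytic_on :: "(real \<Rightarrow> real) \<Rightarrow> real set \<Rightarrow> bool" where
  "real_analytic_on f D \<longleftrightarrow>
     (\<forall>x\<in>D. \<exists>r>0. \<exists>c. \<forall>y. \<bar>y - x\<bar> < r \<longrightarrow> (\<lambda>n. c n * (y - x) ^ n) sums f y)"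

inductive_set generated_algebra :: "'a::real_algebra_1 set \<Rightarrow> 'a set" for X where
  gen: "x \<in> X \<Longrightarrow> x \<in> generated_algebra X"
| scalar: "of_real r \<in> generated_algebra X"
| add: "x \<in> generated_algebra X \<Longrightarrow> y \<in> generated_algebra X \<Longrightarrow> x + y \<in> generated_algebra X"
| mult: "x \<in> generated_algebra X \<Longrightarrow> y \<in> generated_algebra X \<Longrightarrow> x * y \<in> generated_algebra X"

text \<open>
  As \<open>H\<close> is self-conjugate, functions of \<open>H\<close> are complex-valued functions of a real variable.
  They are taken from an algebra \<open>F\<close> of functions, considered on an open set \<open>D\<close> of reals which
  \<open>f\<close> maps bijectively onto itself, so that \<open>f\<close> and its compositional inverse can be iterated;
  \<open>F\<close> is closed under composition with both.  Values outside \<open>D\<close> are irrelevant.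
  The element \<open>g(H)\<close> of the algebra is written \<open>ev g\<close>.  The complex scalar \<open>c\<close> is
  \<open>ev (\<lambda>_. c)\<close>, which is central by the relations below; for real \<open>c\<close> it is \<open>of_real c\<close>.
  The conjugation is \<open>star\<close>, and \<open>ad\<close> is the conjugate of \<open>a\<close>.
\<close>

locale generalized_heisenberg_algebra =
  fixes D :: "real set"
    and f :: "real \<Rightarrow> real"
    and F :: "(real \<Rightarrow> complex) set"
    and ev :: "(real \<Rightarrow> complex) \<Rightarrow> 'a::real_algebra_1"
    and star :: "'a \<Rightarrow> 'a"
    and a ad H :: 'a
  assumes open_D: "open D"
    and f_analytic: "real_analytic_on f D"
    and f_bij: "bij_betw f D D"
    and F_const: "(\<lambda>_. c) \<in> F"
    and F_id: "(\<lambda>x. complex_of_real x) \<in> F"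
    and F_add: "g \<in> F \<Longrightarrow> h \<in> F \<Longrightarrow> (\<lambda>x. g x + h x) \<in> F"
    and F_mult: "g \<in> F \<Longrightarrow> h \<in> F \<Longrightarrow> (\<lambda>x. g x * h x) \<in> F"
    and F_cnj: "g \<in> F \<Longrightarrow> (\<lambda>x. cnj (g x)) \<in> F"
    and F_comp: "g \<in> F \<Longrightarrow> (\<lambda>x. g (f x)) \<in> F"
    and F_comp_inv: "g \<in> F \<Longrightarrow> (\<lambda>x. g (the_inv_into D f x)) \<in> F"
    and ev_cong: "g \<in> F \<Longrightarrow> h \<in> F \<Longrightarrow> (\<And>x. x \<in> D \<Longrightarrow> g x = h x) \<Longrightarrow> ev g = ev h"
    and ev_of_real: "ev (\<lambda>_. complex_of_real r) = of_real r"
    and ev_id: "ev (\<lambda>x. complex_of_real x) = H"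
    and ev_add: "g \<in> F \<Longrightarrow> h \<in> F \<Longrightarrow> ev (\<lambda>x. g x + h x) = ev g + ev h"
    and ev_mult: "g \<in> F \<Longrightarrow> h \<in> F \<Longrightarrow> ev (\<lambda>x. g x * h x) = ev g * ev h"
    and star_star: "star (star x) = x"
    and star_add: "star (x + y) = star x + star y"
    and star_mult: "star (x * y) = star y * star x"
    and star_ev: "g \<in> F \<Longrightarrow> star (ev g) = ev (\<lambda>x. cnj (g x))"
    and star_a: "star a = ad"
    and generated: "generated_algebra (insert a (insert ad (ev ` F))) = UNIV"
    and a_H: "a * H = ev (\<lambda>x. complex_of_real (f x)) * a"
    and H_ad: "H * ad = ad * ev (\<lambda>x. complex_of_real (f x))"
    and commutator: "a * ad - ad * a = ev (\<lambda>x. complex_of_real (f x)) - H"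
    and a_ev: "g \<in> F \<Longrightarrow> a * ev g = ev (\<lambda>x. g (f x)) * a"
    and ev_ad: "g \<in> F \<Longrightarrow> ev g * ad = ad * ev (\<lambda>x. g (f x))"

primrec degenerate_ffact :: "real \<Rightarrow> 'a::real_algebra_1 \<Rightarrow> nat \<Rightarrow> 'a" where
  "degenerate_ffact l x 0 = 1"
| "degenerate_ffact l x (Suc n) = degenerate_ffact l x n * (x - of_real (real n * l))"

definition left_independent_over :: "'a::ring_1 set \<Rightarrow> (nat \<Rightarrow> 'a) \<Rightarrow> bool" where
  "left_independent_over K b \<longleftrightarrow>
     (\<forall>n c. (\<forall>k\<le>n. c k \<in> K) \<longrightarrow> (\<Sum>k\<le>n. c k * b k) = 0 \<longrightarrow> (\<forall>k\<le>n. c k = 0))"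

text \<open>
  In the next two definitions \<open>K\<close> is the set of functions of \<open>H\<close>, as elements of the algebra.
  The coefficients with \<open>k > n\<close>, which do not occur in the expansions, are set to \<open>0\<close>.
\<close>

definition degenerate_stirling2 ::
  "'a::real_algebra_1 set \<Rightarrow> 'a \<Rightarrow> 'a \<Rightarrow> real \<Rightarrow> nat \<Rightarrow> nat \<Rightarrow> 'a" where
  "degenerate_stirling2 K a ad l n =
     (THE c. (\<forall>k. c k \<in> K) \<and> (\<forall>k>n. c k = 0) \<and>
        degenerate_ffact l (ad * a) n = (\<Sum>k\<le>n. c k * (ad ^ k * a ^ k)))"

definition degenerate_stirling1 ::
  "'a::real_algebra_1 set \<Rightarrow> 'a \<Rightarrow> 'a \<Rightarrow> real \<Rightarrow> nat \<Rightarrow> nat \<Rightarrow> 'a" where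
  "degenerate_stirling1 K a ad l n =
     (THE c. (\<forall>k. c k \<in> K) \<and> (\<forall>k>n. c k = 0) \<and>
        ad ^ n * a ^ n = (\<Sum>k\<le>n. c k * degenerate_ffact l (ad * a) k))"

end

theory Submission
  imports Defs
begin

text \<open>
  Write \<open>K\<close> for the functions of \<open>H\<close>, \<open>N = ad * a\<close> for the number operator, and consider the two
  sequences \<open>B k = ad ^ k * a ^ k\<close> and \<open>E k = (N)\<^sub>k\<close> (the degenerate falling factorial).
  As \<open>E\<close> and \<open>B\<close> are independent over \<open>K\<close>, mutual inversion of the two expansions is the
  statement that two triangular change-of-basis matrices are inverse to each other: substitute one
  expansion into the other and compare coefficients.

  The Stirling operators are given by definite descriptions, so they satisfy their defining
  expansions only once such expansions are known to exist; this is where the relations of the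
  algebra enter.  Both sequences start at \<open>1\<close> and satisfy a recurrence of the same
  shape under right multiplication by \<open>N\<close>:
  \<open>X k * N = X (Suc k) + q k * X k\<close> with \<open>q k\<close> in \<open>K\<close>.
  For \<open>E\<close> this is the definition, with the scalar \<open>q k = k l\<close>.  For \<open>B\<close> it follows from the
  commutator: moving \<open>a\<close> past \<open>ad\<close> produces only functions of \<open>H\<close>, and these can be moved to the
  left past \<open>ad\<close> because \<open>f\<close> is invertible (\<open>normal_product_mult_number\<close>).
  Two sequences with such recurrences and the same initial value are expressible through each other
  with triangular coefficients (\<open>expansion_exists\<close>), which settles both kinds at once.
\<close>

section \<open>Triangular expansions over a ring of left coefficients\<close>

text \<open>
  Functions of \<open>H\<close> do not commute with \<open>a\<close> and \<open>ad\<close>, so the coefficients of an expansion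
  have to stay on the left, while recurrences multiply by the number operator on the right.
\<close>

locale left_coefficients =
  fixes K :: "'a::ring_1 set"
  assumes one_mem: "1 \<in> K"
    and diff_mem: "x \<in> K \<Longrightarrow> y \<in> K \<Longrightarrow> x - y \<in> K"
    and mult_mem: "x \<in> K \<Longrightarrow> y \<in> K \<Longrightarrow> x * y \<in> K"
begin

lemma zero_mem: "0 \<in> K"
  using diff_mem[OF one_mem one_mem] by simp

lemma add_mem: "x \<in> K \<Longrightarrow> y \<in> K \<Longrightarrow> x + y \<in> K"
  using diff_mem[of x "0 - y"] diff_mem[OF zero_mem, of y] by simp

lemma sum_mem: "(\<And>i. i \<in> A \<Longrightarrow> g i \<in> K) \<Longrightarrow> sum g A \<in> K"
  by (induction A rule: infinite_finite_induct) (auto simp: zero_mem add_mem)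

text \<open>
  The body is the one under the definite description in both Stirling operators, so that
  they become \<open>THE c. expansion (E n) B n c\<close> and \<open>THE c. expansion (B n) E n c\<close>.
\<close>

definition expansion :: "'a \<Rightarrow> (nat \<Rightarrow> 'a) \<Rightarrow> nat \<Rightarrow> (nat \<Rightarrow> 'a) \<Rightarrow> bool" where
  "expansion x Y n c \<longleftrightarrow>
     (\<forall>k. c k \<in> K) \<and> (\<forall>k>n. c k = 0) \<and> x = (\<Sum>k\<le>n. c k * Y k)"

lemma expansion_unique:
  assumes "left_independent_over K Y" "expansion x Y n c" "expansion x Y n d"
  shows "c = d"
proof
  fix k
  have "(\<Sum>i\<le>n. (c i - d i) * Y i) = 0"
    using assms(2,3) by (simp add: expansion_def left_diff_distrib sum_subtractf)
  moreover have "\<forall>i\<le>n. c i - d i \<in> K"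
    using assms(2,3) by (auto simp: expansion_def intro: diff_mem)
  ultimately have "\<forall>i\<le>n. c i - d i = 0"
    using assms(1)[unfolded left_independent_over_def, rule_format, of n "\<lambda>i. c i - d i"]
    by blast
  then show "c k = d k"
    using assms(2,3) by (cases "k \<le> n") (auto simp: expansion_def)
qed

text \<open>
  Write \<open>X n\<close> as a combination of the \<open>Y k\<close> and multiply by \<open>N\<close> on the right: the
  recurrence of \<open>Y\<close> shifts each term up by one or rescales it, and the recurrence of \<open>X\<close>
  isolates \<open>X (Suc n)\<close>.
\<close>

lemma expansion_exists:
  assumes init: "X 0 = Y 0"
    and X: "\<And>k. X k * N = X (Suc k) + p k * X k" "\<And>k. p k \<in> K"
    and Y: "\<And>k. Y k * N = Y (Suc k) + q k * Y k" "\<And>k. q k \<in> K"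
  shows "\<exists>c. expansion (X n) Y n c"
proof (induction n)
  case 0
  have "expansion (X 0) Y 0 (\<lambda>k. if k = 0 then 1 else 0)"
    by (simp add: expansion_def init one_mem zero_mem)
  then show ?case by blast
next
  case (Suc n)
  then obtain c where c: "\<And>k. c k \<in> K" "\<And>k. k > n \<Longrightarrow> c k = 0" "X n = (\<Sum>k\<le>n. c k * Y k)"
    by (auto simp: expansion_def)
  define d where
    "d k = (case k of 0 \<Rightarrow> 0 | Suc i \<Rightarrow> c i) + (c k * q k - p n * c k)" for k
  have "X (Suc n) = X n * N - p n * X n"
    by (simp add: X(1))
  also have "\<dots> = (\<Sum>k\<le>n. c k * Y (Suc k)) + (\<Sum>k\<le>n. (c k * q k - p n * c k) * Y k)"
    by (simp add: c(3) sum_distrib_right sum_distrib_left mult.assoc Y(1) distrib_left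
        left_diff_distrib sum.distrib sum_subtractf)
  also have "(\<Sum>k\<le>n. c k * Y (Suc k)) = (\<Sum>k\<le>Suc n. (case k of 0 \<Rightarrow> 0 | Suc i \<Rightarrow> c i) * Y k)"
    by (simp add: sum.atMost_Suc_shift del: sum.atMost_Suc)
  also have "(\<Sum>k\<le>n. (c k * q k - p n * c k) * Y k) =
      (\<Sum>k\<le>Suc n. (c k * q k - p n * c k) * Y k)"
    by (simp add: c(2))
  finally have "X (Suc n) = (\<Sum>k\<le>Suc n. d k * Y k)"
    by (simp only: d_def distrib_right sum.distrib)
  moreover have "d k \<in> K" for k
    by (auto simp: d_def split: nat.split
        intro!: add_mem diff_mem mult_mem c(1) X(2) Y(2) zero_mem)
  moreover have "d k = 0" if "k > Suc n" for k
    using that by (auto simp: d_def c(2) split: nat.split)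
  ultimately show ?case by (auto simp: expansion_def)
qed

lemma expansion_The:
  assumes "left_independent_over K Y" "\<exists>c. expansion x Y n c"
  shows "expansion x Y n (THE c. expansion x Y n c)"
proof -
  obtain c where c: "expansion x Y n c"
    using assms(2) ..
  then show ?thesis
    by (rule theI[where P = "expansion x Y n"]) (rule expansion_unique[OF assms(1) _ c])
qed

text \<open>
  Substituting the second expansion into the first writes \<open>X n\<close> in terms of the \<open>X j\<close> with the
  entries of the matrix product as coefficients; by uniqueness this is the trivial expansion of
  \<open>X n\<close>.  The bounds \<open>j\<close> and \<open>n\<close> of the sum are where the coefficients can be nonzero.
\<close>

lemma expansion_inversion:
  assumes indep: "left_independent_over K X"
    and s: "\<And>n. expansion (X n) Y n (s n)"
    and t: "\<And>n. expansion (Y n) X n (t n)"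
  shows "(\<Sum>k=j..n. s n k * t k j) = (if n = j then 1 else 0)"
proof -
  define u where "u j = (\<Sum>k\<le>n. s n k * t k j)" for j
  have t0: "t k i = 0" if "k < i" for k i
    using t[of k] that unfolding expansion_def by blast
  have coeff_mem: "s k i \<in> K" "t k i \<in> K" for k i
    using s[of k] t[of k] unfolding expansion_def by blast+
  have X_eq: "X n = (\<Sum>k\<le>n. s n k * Y k)" and Y_eq: "Y k = (\<Sum>i\<le>k. t k i * X i)" for k
    using s[of n] t[of k] unfolding expansion_def by blast+
  have "X n = (\<Sum>k\<le>n. s n k * (\<Sum>i\<le>k. t k i * X i))"
    using X_eq by (rule trans) (intro sum.cong refl arg_cong2[where f = "(*)"] Y_eq)
  \<comment> \<open>Padding the inner sums with the zero coefficients makes the ranges independent.\<close>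
  also have "\<dots> = (\<Sum>k\<le>n. s n k * (\<Sum>i\<le>n. t k i * X i))"
    by (intro sum.cong arg_cong2[where f = "(*)"] sum.mono_neutral_left) (auto simp: t0)
  also have "\<dots> = (\<Sum>i\<le>n. u i * X i)"
    unfolding u_def sum_distrib_left sum_distrib_right
    by (subst sum.swap) (simp add: mult.assoc)
  finally have "X n = (\<Sum>i\<le>n. u i * X i)" .
  moreover have "u i \<in> K" for i
    unfolding u_def by (intro sum_mem mult_mem coeff_mem)
  moreover have "u i = 0" if "i > n" for i
    using that by (auto simp: u_def t0 intro!: sum.neutral)
  ultimately have u: "expansion (X n) X n u"
    unfolding expansion_def by blast
  have "expansion (X n) X n (\<lambda>i. if n = i then 1 else 0)"
    by (simp add: expansion_def one_mem zero_mem if_distrib[of "\<lambda>c. c * _"] cong: if_cong)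
  with u have "u = (\<lambda>i. if n = i then 1 else 0)"
    by (rule expansion_unique[OF indep])
  moreover have "u j = (\<Sum>k=j..n. s n k * t k j)"
    unfolding u_def by (intro sum.mono_neutral_right) (auto simp: t0)
  ultimately show ?thesis by simp
qed

end

section \<open>Normally ordered products in the generalized Heisenberg algebra\<close>

text \<open>Real scalars are central, so the shift can be moved to the left of the falling factorial.\<close>

lemma degenerate_ffact_mult:
  "degenerate_ffact l x k * x =
     degenerate_ffact l x (Suc k) + of_real (real k * l) * degenerate_ffact l x k"
  by (simp add: right_diff_distrib of_real_def del: of_real_mult)

context generalized_heisenberg_algebra
begin

lemma left_coefficients_functions: "left_coefficients (ev ` F)"
proof
  show "1 \<in> ev ` F"
    using imageI[OF F_const, of ev 1] ev_of_real[of 1] by simp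
  fix x y assume "x \<in> ev ` F" "y \<in> ev ` F"
  then obtain g h where gh: "g \<in> F" "h \<in> F" "x = ev g" "y = ev h" by blast
  have "x + ev (\<lambda>_. complex_of_real (-1)) * y \<in> ev ` F"
    using imageI[OF F_add[OF gh(1) F_mult[OF F_const gh(2)]], of ev]
    unfolding ev_add[OF gh(1) F_mult[OF F_const gh(2)]] ev_mult[OF F_const gh(2)] gh(3,4) .
  then show "x - y \<in> ev ` F"
    unfolding ev_of_real by simp
  show "x * y \<in> ev ` F"
    using imageI[OF F_mult[OF gh(1,2)], of ev] unfolding ev_mult[OF gh(1,2)] gh(3,4) .
qed

sublocale left_coefficients "ev ` F"
  by (rule left_coefficients_functions)

text \<open>
  Applying the relation \<open>ev g * ad = ad * ev (g \<circ> f)\<close> to \<open>g \<circ> f\<^sup>-\<^sup>1\<close>; the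
  compositional inverse is inverse only on \<open>D\<close>, which suffices by \<open>ev_cong\<close>.
\<close>

lemma ad_ev: "g \<in> F \<Longrightarrow> ad * ev g = ev (\<lambda>x. g (the_inv_into D f x)) * ad"
proof -
  assume g: "g \<in> F"
  have "ev (\<lambda>x. g (the_inv_into D f (f x))) = ev g"
    using f_bij g F_comp[OF F_comp_inv[OF g]]
    by (intro ev_cong) (auto simp: bij_betw_def the_inv_into_f_f)
  then show ?thesis
    using ev_ad[OF F_comp_inv[OF g]] by simp
qed

lemma ad_function: "x \<in> ev ` F \<Longrightarrow> \<exists>y\<in>ev ` F. ad * x = y * ad"
  using ad_ev F_comp_inv by blast

text \<open>The twists by \<open>f\<close> and its inverse that \<open>a ^ k\<close> and \<open>ad ^ k\<close> cause cancel.\<close>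

lemma normal_product_commute: "g \<in> F \<Longrightarrow> ad ^ k * a ^ k * ev g = ev g * (ad ^ k * a ^ k)"
proof (induction k arbitrary: g)
  case 0
  then show ?case by simp
next
  case (Suc k)
  have S: "ad ^ Suc k * a ^ Suc k = ad * (ad ^ k * a ^ k) * a"
    by (simp only: power_Suc[of ad] power_Suc2[of a] mult.assoc)
  have "ad ^ Suc k * a ^ Suc k * ev g = ad * (ad ^ k * a ^ k * ev (\<lambda>x. g (f x))) * a"
    by (simp only: S mult.assoc a_ev[OF Suc.prems])
  also have "\<dots> = (ad * ev (\<lambda>x. g (f x))) * (ad ^ k * a ^ k) * a"
    by (subst Suc.IH[OF F_comp[OF Suc.prems]]) (simp only: mult.assoc)
  also have "\<dots> = ev g * (ad ^ Suc k * a ^ Suc k)"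
    by (simp only: S mult.assoc ev_ad[OF Suc.prems, symmetric])
  finally show ?case .
qed

text \<open>
  In \<open>ad * B k * a * ad * a\<close> the commutator replaces the inner \<open>a * ad\<close> by
  \<open>N + f(H) - H\<close>; the induction hypothesis handles \<open>N\<close>, the function of \<open>H\<close> commutes
  with \<open>B k\<close>, and everything in front moves to the left past the single outer \<open>ad\<close>.
\<close>

lemma normal_product_mult_number:
  "\<exists>q\<in>ev ` F. ad ^ k * a ^ k * (ad * a) = ad ^ Suc k * a ^ Suc k + q * (ad ^ k * a ^ k)"
proof (induction k)
  case 0
  show ?case by (simp add: zero_mem)
next
  case (Suc k)
  let ?B = "\<lambda>k. ad ^ k * a ^ k"
  have S: "?B (Suc i) = ad * ?B i * a" for i
    by (simp only: power_Suc[of ad] power_Suc2[of a] mult.assoc)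
  from Suc obtain q where q: "q \<in> ev ` F" "?B k * (ad * a) = ?B (Suc k) + q * ?B k" by blast
  define fH where "fH = ev (\<lambda>x. complex_of_real (f x))"
  have mem: "fH \<in> ev ` F" "H \<in> ev ` F"
    using F_comp[OF F_id] F_id ev_id by (auto simp: fH_def)
  have comm: "?B k * (fH - H) = (fH - H) * ?B k"
    using normal_product_commute[OF F_comp[OF F_id], of k] normal_product_commute[OF F_id, of k]
    by (simp add: fH_def ev_id algebra_simps)
  have "q + (fH - H) \<in> ev ` F"
    by (intro add_mem diff_mem q(1) mem)
  then obtain r where r: "r \<in> ev ` F" "ad * (q + (fH - H)) = r * ad"
    using ad_function by blast
  have a_ad: "a * ad = ad * a + (fH - H)"
    using commutator by (simp add: fH_def algebra_simps)
  have "?B (Suc k) * (ad * a) = ad * (?B k * (a * ad)) * a"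
    by (simp only: S mult.assoc)
  also have "?B k * (a * ad) = ?B (Suc k) + (q + (fH - H)) * ?B k"
    unfolding a_ad distrib_left comm q(2) by (simp only: distrib_right add.assoc)
  also have "ad * (?B (Suc k) + (q + (fH - H)) * ?B k) * a =
      ad * ?B (Suc k) * a + (ad * (q + (fH - H))) * ?B k * a"
    by (subst distrib_left) (simp only: distrib_right[of _ _ a] mult.assoc)
  also have "\<dots> = ?B (Suc (Suc k)) + r * ?B (Suc k)"
    unfolding r(2) by (simp only: S mult.assoc)
  finally show ?case using r(1) by blast
qed

lemma of_real_mem: "of_real r \<in> ev ` F"
  using imageI[OF F_const, of ev "complex_of_real r"] unfolding ev_of_real .

lemma degenerate_ffact_normal_expansions:
  shows "\<exists>c. expansion (degenerate_ffact l (ad * a) n) (\<lambda>k. ad ^ k * a ^ k) n c"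
    and "\<exists>c. expansion (ad ^ n * a ^ n) (degenerate_ffact l (ad * a)) n c"
proof -
  let ?E = "degenerate_ffact l (ad * a)" and ?B = "\<lambda>k. ad ^ k * a ^ k"
  have "\<forall>k. \<exists>q. q \<in> ev ` F \<and> ?B k * (ad * a) = ?B (Suc k) + q * ?B k"
    using normal_product_mult_number by blast
  from choice[OF this] obtain q where
    q: "\<And>k. q k \<in> ev ` F" "\<And>k. ?B k * (ad * a) = ?B (Suc k) + q k * ?B k"
    by blast
  show "\<exists>c. expansion (degenerate_ffact l (ad * a) n) (\<lambda>k. ad ^ k * a ^ k) n c"
    by (rule expansion_exists[where X = ?E and Y = ?B,
          OF _ degenerate_ffact_mult of_real_mem q(2,1)]) simp
  show "\<exists>c. expansion (ad ^ n * a ^ n) (degenerate_ffact l (ad * a)) n c"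
    by (rule expansion_exists[where X = ?B and Y = ?E,
          OF _ q(2,1) degenerate_ffact_mult of_real_mem]) simp
qed

end

section \<open>Inversion of the degenerate generalized Stirling operators\<close>

theorem theorem3p3:
  fixes D :: "real set"
    and f :: "real \<Rightarrow> real"
    and F :: "(real \<Rightarrow> complex) set"
    and ev :: "(real \<Rightarrow> complex) \<Rightarrow> 'a::real_algebra_1"
    and star :: "'a \<Rightarrow> 'a"
    and a ad H :: 'a
    and l :: real
    and n j :: nat
  assumes "generalized_heisenberg_algebra D f F ev star a ad H"
    and "l \<noteq> 0"
    and "left_independent_over (ev ` F) (\<lambda>k. degenerate_ffact l (ad * a) k)"
    and "left_independent_over (ev ` F) (\<lambda>k. ad ^ k * a ^ k)"
  shows "(\<Sum>k=j..n. degenerate_stirling1 (ev ` F) a ad l n k * degenerate_stirling2 (ev ` F) a ad l k j)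
           = (if n = j then 1 else 0) \<and>
         (\<Sum>k=j..n. degenerate_stirling2 (ev ` F) a ad l n k * degenerate_stirling1 (ev ` F) a ad l k j)
           = (if n = j then 1 else 0)"
proof -
  interpret generalized_heisenberg_algebra D f F ev star a ad H by (rule assms(1))
  let ?E = "degenerate_ffact l (ad * a)" and ?B = "\<lambda>k. ad ^ k * a ^ k"
  let ?S1 = "degenerate_stirling1 (ev ` F) a ad l" and ?S2 = "degenerate_stirling2 (ev ` F) a ad l"
  have S2: "expansion (?E m) ?B m (?S2 m)" for m
    using expansion_The[OF assms(4) degenerate_ffact_normal_expansions(1)[of l m]]
    unfolding degenerate_stirling2_def expansion_def .
  have S1: "expansion (?B m) ?E m (?S1 m)" for m
    using expansion_The[OF assms(3) degenerate_ffact_normal_expansions(2)[of m l]]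
    unfolding degenerate_stirling1_def expansion_def .
  show ?thesis
    using expansion_inversion[where X = ?B and Y = ?E and s = ?S1 and t = ?S2, OF assms(4) S1 S2]
      expansion_inversion[where X = ?E and Y = ?B and s = ?S2 and t = ?S1, OF assms(3) S2 S1]
    by (rule conjI)
qed

end
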